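(* For $n\ge 0$ let $C_n(u,\alpha)=\sum_{i=0}^n\binom ni (\alpha)_i\,u^{n-i}$. Then, as formal power series in $x$, \[\sum_{m\ge0} C_{2m}(u,\alpha)\frac{x^m}{m!}=e^{u^2x}\sum_{k\ge0}\frac{(\alpha)_{2k}}{(1-2ux)^{2k+\alpha}}\frac{x^k}{k!}.\]
   Context: $(\alpha)_n=\alpha(\alpha+1)\cdots(\alpha+n-1)$ is the rising factorial with $(\alpha)_0=1$; $u$ and $\alpha$ are indeterminates (or complex parameters), and $(1-2ux)^{-\beta}$ denotes the formal binomial series. *)

theory Defs
  imports "HOL-Computational_Algebra.Formal_Power_Series"
begin

definition C_poly :: "nat \<Rightarrow> 'a::field_char_0 \<Rightarrow> 'a \<Rightarrow> 'a" where
  "C_poly n u \<alpha> = (\<Sum>i=0..n. of_nat (n choose i) * pochhammer \<alpha> i * u ^ (n - i))"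

text \<open>
  The formal binomial series of \<open>(1 - 2ux) powr (-\<beta>)\<close>: the series of \<open>(1 + x) powr (-\<beta>)\<close>,
  with \<open>-2ux\<close> (which has no constant term, as \<open>fps_compose\<close> requires) substituted for \<open>x\<close>.
\<close>
definition binomial_series :: "'a::field_char_0 \<Rightarrow> 'a \<Rightarrow> 'a fps" where
  "binomial_series u \<beta> = fps_binomial (- \<beta>) oo (- (fps_const (2 * u) * fps_X))"

lemma binomial_series_nth:
  "fps_nth (binomial_series u \<beta>) j = pochhammer \<beta> j / fact j * (2 * u) ^ j"
proof -
  have "- (fps_const (2 * u) * fps_X) = fps_const (- (2 * u)) * fps_X"
    by (simp flip: fps_const_neg)
  then have "fps_nth (binomial_series u \<beta>) j = (- (2 * u)) ^ j * (- \<beta> gchoose j)"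
    by (simp only: binomial_series_def fps_compose_linear fps_nth_Abs_fps fps_binomial_nth)
  also have "(- \<beta> gchoose j) = (- 1) ^ j * pochhammer \<beta> j / fact j"
    by (simp add: gbinomial_pochhammer)
  also have "(- (2 * u)) ^ j * \<dots> = (- (2 * u) * (- 1)) ^ j * (pochhammer \<beta> j / fact j)"
    by (simp only: power_mult_distrib times_divide_eq_right mult.assoc)
  finally show ?thesis
    by (simp only: minus_mult_minus mult_1_right mult_1_left mult.commute)
qed

end

theory Submission
  imports Defs "HOL-Computational_Algebra.Polynomial"
begin

text \<open>
  Umbrally, \<open>C_poly n u \<alpha>\<close> is the image of \<open>(u + z) ^ n\<close> under the linear functional
  that sends \<open>z ^ i\<close> to \<open>pochhammer \<alpha> i\<close>. Write \<open>(u + z) ^ (2 * m) = (u\<^sup>2 + z * (2 * u + z)) ^ m\<close>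
  and expand: the first summand produces the factor \<open>exp (u\<^sup>2 x)\<close>, and expanding
  \<open>(2 * u + z) ^ n\<close> produces the sum over \<open>k\<close>, because
  \<open>pochhammer \<alpha> (n + k) = pochhammer \<alpha> (2 * k) * pochhammer (2 * k + \<alpha>) (n - k)\<close>.
\<close>

definition umbral :: "'a::comm_ring_1 \<Rightarrow> 'a poly \<Rightarrow> 'a" where
  "umbral \<alpha> p = (\<Sum>i\<le>degree p. coeff p i * pochhammer \<alpha> i)"

text \<open>Coefficients above the degree vanish. A common bound \<open>N\<close> lets polynomials
  of different degrees be summed over one range, which is what additivity needs.\<close>

lemma umbral_altdef:
  assumes "degree p \<le> N"
  shows "umbral \<alpha> p = (\<Sum>i\<le>N. coeff p i * pochhammer \<alpha> i)"
  unfolding umbral_def using assms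
  by (intro sum.mono_neutral_left) (auto simp: coeff_eq_0)

lemma umbral_0 [simp]: "umbral \<alpha> 0 = 0"
  by (simp add: umbral_def)

lemma umbral_add: "umbral \<alpha> (p + q) = umbral \<alpha> p + umbral \<alpha> q"
proof -
  define N where "N = max (degree p) (degree q)"
  have "degree (p + q) \<le> N" "degree p \<le> N" "degree q \<le> N"
    by (simp_all add: N_def degree_add_le_max)
  then show ?thesis
    by (simp add: umbral_altdef [where N = N] distrib_right sum.distrib)
qed

lemma umbral_sum: "umbral \<alpha> (\<Sum>i\<in>A. p i) = (\<Sum>i\<in>A. umbral \<alpha> (p i))"
  by (induction A rule: infinite_finite_induct) (simp_all add: umbral_add)

lemma umbral_monom: "umbral \<alpha> (monom c n) = c * pochhammer \<alpha> n"
proof -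
  have "umbral \<alpha> (monom c n) = (\<Sum>i\<le>n. if i = n then c * pochhammer \<alpha> n else 0)"
    by (subst umbral_altdef [OF degree_monom_le]) (intro sum.cong, auto)
  then show ?thesis
    by simp
qed

text \<open>The binomial theorem, put in monomial form so that \<open>umbral_sum\<close> and
  \<open>umbral_monom\<close> evaluate the functional termwise.\<close>

lemma linear_poly_power_eq_sum_monom:
  fixes a :: "'a::comm_ring_1"
  shows "[:a, 1:] ^ n = (\<Sum>i\<le>n. monom (of_nat (n choose i) * a ^ (n - i)) i)"
proof -
  have "[:a, 1:] = monom 1 1 + [:a:]"
    by (simp add: monom_altdef)
  then have "[:a, 1:] ^ n = (\<Sum>i\<le>n. of_nat (n choose i) * monom 1 1 ^ i * [:a:] ^ (n - i))"
    by (simp only: binomial_ring)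
  also have "\<dots> = (\<Sum>i\<le>n. monom (of_nat (n choose i) * a ^ (n - i)) i)"
    by (intro sum.cong refl) (simp add: monom_power poly_const_pow of_nat_poly smult_monom mult.commute)
  finally show ?thesis .
qed

lemma C_poly_umbral: "C_poly n u \<alpha> = umbral \<alpha> ([:u, 1:] ^ n)"
  unfolding linear_poly_power_eq_sum_monom umbral_sum umbral_monom C_poly_def atMost_atLeast0
  by (simp add: mult_ac)

lemma C_poly_even:
  "C_poly (2 * m) u \<alpha> = (\<Sum>n\<le>m. of_nat (m choose n) * (u ^ 2) ^ (m - n) *
     (\<Sum>k\<le>n. of_nat (n choose k) * (2 * u) ^ (n - k) * pochhammer \<alpha> (n + k)))"
proof -
  have "[:u, 1:] ^ 2 = monom 1 1 * [:2 * u, 1:] + [:u ^ 2:]"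
    by (simp add: monom_altdef power2_eq_square algebra_simps)
  then have "[:u, 1:] ^ (2 * m) = (\<Sum>n\<le>m. of_nat (m choose n) *
      (monom 1 1 * [:2 * u, 1:]) ^ n * [:u ^ 2:] ^ (m - n))"
    by (simp only: power_mult binomial_ring)
  \<comment> \<open>Second binomial expansion, now of \<open>[:2 * u, 1:] ^ n\<close>; the factor
    \<open>monom 1 1 ^ n\<close> shifts the exponent from \<open>k\<close> to
    \<open>n + k\<close>.\<close>
  also have "\<dots> = (\<Sum>n\<le>m. \<Sum>k\<le>n. monom (of_nat (m choose n) * (u ^ 2) ^ (m - n) *
      (of_nat (n choose k) * (2 * u) ^ (n - k))) (n + k))"
    by (intro sum.cong refl, simp only: power_mult_distrib linear_poly_power_eq_sum_monom
          sum_distrib_left sum_distrib_right, intro sum.cong refl)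
       (simp add: monom_power poly_const_pow of_nat_poly smult_monom mult_monom mult_ac)
  finally show ?thesis
    by (simp add: C_poly_umbral umbral_sum umbral_monom sum_distrib_left mult.assoc)
qed

text \<open>Convergence of formal power series means that each coefficient is eventually constant;
  here coefficient \<open>n\<close> of the partial sums is fixed once all \<open>k \<le> n\<close>
  are included.\<close>

lemma fps_sums_nthI:
  fixes f :: "nat \<Rightarrow> 'a::comm_ring_1 fps"
  assumes "\<And>n k. n < k \<Longrightarrow> fps_nth (f k) n = 0"
  shows "f sums Abs_fps (\<lambda>n. \<Sum>k\<le>n. fps_nth (f k) n)"
  unfolding sums_def
proof (rule tendsto_fpsI)
  fix n
  have "fps_nth (\<Sum>k<N. f k) n = (\<Sum>k\<le>n. fps_nth (f k) n)" if "Suc n \<le> N" for N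
    unfolding fps_sum_nth using that assms by (intro sum.mono_neutral_right) auto
  then show "\<forall>\<^sub>F N in sequentially.
      fps_nth (\<Sum>k<N. f k) n = fps_nth (Abs_fps (\<lambda>n. \<Sum>k\<le>n. fps_nth (f k) n)) n"
    by (intro eventually_sequentiallyI [of "Suc n"]) simp
qed

theorem theorem3p2:
  fixes u \<alpha> :: "'a::field_char_0"
  shows "let T = (\<lambda>k. fps_const (pochhammer \<alpha> (2 * k)) * binomial_series u (of_nat (2 * k) + \<alpha>)
                        * (fps_const (1 / fact k) * fps_X ^ k))
         in summable T \<and>
            Abs_fps (\<lambda>m. C_poly (2 * m) u \<alpha> / fact m) = fps_exp (u ^ 2) * (\<Sum>k. T k)"
proof -
  define T where "T = (\<lambda>k. fps_const (pochhammer \<alpha> (2 * k)) *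
    binomial_series u (of_nat (2 * k) + \<alpha>) * (fps_const (1 / fact k) * fps_X ^ k))"
  define S where "S n = (\<Sum>k\<le>n. of_nat (n choose k) * (2 * u) ^ (n - k) * pochhammer \<alpha> (n + k))" for n
  have T_shift: "T k = fps_const (pochhammer \<alpha> (2 * k) / fact k) *
      binomial_series u (of_nat (2 * k) + \<alpha>) * fps_X ^ k" for k
  proof -
    have "T k = (fps_const (pochhammer \<alpha> (2 * k)) * fps_const (1 / fact k)) *
        binomial_series u (of_nat (2 * k) + \<alpha>) * fps_X ^ k"
      by (simp only: T_def mult_ac)
    then show ?thesis
      by simp
  qed
  have T_nth: "fps_nth (T k) n = of_nat (n choose k) * (2 * u) ^ (n - k) * pochhammer \<alpha> (n + k) / fact n"
    if "k \<le> n" for k n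
  proof -
    \<comment> \<open>Splitting off the first \<open>2 * k\<close> factors requires
      \<open>2 * k \<le> n + k\<close>, that is, \<open>k \<le> n\<close>.\<close>
    have "pochhammer \<alpha> (n + k) = pochhammer \<alpha> (2 * k) * pochhammer (of_nat (2 * k) + \<alpha>) (n - k)"
      using pochhammer_product [of "2 * k" "n + k" \<alpha>] that by (simp add: add.commute)
    moreover have "fps_nth (T k) n = pochhammer \<alpha> (2 * k) / fact k *
        (pochhammer (of_nat (2 * k) + \<alpha>) (n - k) / fact (n - k) * (2 * u) ^ (n - k))"
      using that unfolding T_shift fps_X_power_mult_right_nth
      by (simp only: not_less [symmetric] if_False fps_mult_left_const_nth binomial_series_nth)
    ultimately show ?thesis
      using that by (simp add: binomial_fact)
  qed
  \<comment> \<open>\<open>T k\<close> is a multiple of \<open>fps_X ^ k\<close>, so its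
    coefficients below \<open>k\<close> vanish.\<close>
  have T_sums: "T sums Abs_fps (\<lambda>n. \<Sum>k\<le>n. fps_nth (T k) n)"
    by (rule fps_sums_nthI) (simp add: T_shift fps_X_power_mult_right_nth)
  have "(\<Sum>k. T k) = Abs_fps (\<lambda>n. S n / fact n)"
    unfolding sums_unique [OF T_sums, symmetric] S_def
    by (intro arg_cong [where f = Abs_fps] ext) (simp add: T_nth sum_divide_distrib)
  \<comment> \<open>\<open>C_poly_even\<close> is a binomial convolution of \<open>S\<close> with
    the powers of \<open>u ^ 2\<close>, so the exponential generating functions multiply.\<close>
  moreover have "Abs_fps (\<lambda>m. C_poly (2 * m) u \<alpha> / fact m) =
      fps_exp (u ^ 2) * Abs_fps (\<lambda>n. S n / fact n)"
  proof (rule fps_ext)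
    fix m
    have "C_poly (2 * m) u \<alpha> / fact m =
        (\<Sum>n\<le>m. S n / fact n * ((u ^ 2) ^ (m - n) / fact (m - n)))"
      unfolding C_poly_even S_def [symmetric] sum_divide_distrib
      by (intro sum.cong refl) (simp add: binomial_fact field_simps)
    also have "\<dots> = fps_nth (Abs_fps (\<lambda>n. S n / fact n) * fps_exp (u ^ 2)) m"
      by (simp add: fps_mult_nth atMost_atLeast0)
    finally show "fps_nth (Abs_fps (\<lambda>m. C_poly (2 * m) u \<alpha> / fact m)) m =
        fps_nth (fps_exp (u ^ 2) * Abs_fps (\<lambda>n. S n / fact n)) m"
      by (simp add: mult.commute)
  qed
  ultimately show ?thesis
    using sums_summable [OF T_sums] unfolding Let_def T_def [symmetric] by simp
qed

end
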